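(* Let $K>0$ and $N\ge 1$ be real parameters. Each metric measure space $(M,d,m)$ satisfying the reduced curvature-dimension condition $\mathsf{CD}^*(K,N)$ has compact support, and its diameter $L:=\sup\{d(x,y):x,y\in\mathrm{supp}(m)\}$ satisfies $$L\le\pi\sqrt{\frac{N}{K}}.$$
   Context: A metric measure space $(M,d,m)$ consists of a complete separable metric space $(M,d)$ and a locally finite Borel measure $m$ (for every $x\in M$, $m(B_r(x))<\infty$ for all sufficiently small $r>0$). "Compact support" means $\mathrm{supp}(m)$ is compact. No non-branching assumption is made. $\mathcal{P}_2(M,d)$ is the space of Borel probability measures with finite second moment, with the $L_2$-Wasserstein distance $d_W(\mu,\nu)=\inf_q\big(\int d^2\,dq\big)^{1/2}$ over couplings $q$ of $\mu,\nu$; optimal couplings are the minimizers. $\mathcal{P}_\infty(M,d,m)$ is the subspace of $m$-absolutely continuous probability measures with bounded support. A geodesic $\Gamma:[0,1]\to\mathcal{P}_\infty(M,d,m)$ is a curve with $d_W(\Gamma(s),\Gamma(t))=|s-t|\,d_W(\Gamma(0),\Gamma(1))$. For $\nu=\rho m$ and $N'\ge 1$, $S_{N'}(\nu|m):=-\int_M\rho^{1-1/N'}\,dm$ (with $0^0=0$ when $N'=1$). For $K>0$, $\theta\ge 0$, $t\in[0,1]$: $\sigma^{(t)}_{K,N}(\theta)=\infty$ if $K\theta^2\ge N\pi^2$, and $\sigma^{(t)}_{K,N}(\theta)=\frac{\sin(t\theta\sqrt{K/N})}{\sin(\theta\sqrt{K/N})}$ otherwise (value $t$ at $\theta=0$).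 $\mathsf{CD}^*(K,N)$: for all $\nu_0=\rho_0m,\nu_1=\rho_1m\in\mathcal{P}_\infty(M,d,m)$ there exist an optimal coupling $q$ of $\nu_0,\nu_1$ and a geodesic $\Gamma:[0,1]\to\mathcal{P}_\infty(M,d,m)$ connecting them such that for all $t\in[0,1]$ and all $N'\ge N$, $$S_{N'}(\Gamma(t)|m)\le-\int_{M\times M}\Big[\sigma^{(1-t)}_{K,N'}(d(x_0,x_1))\rho_0^{-1/N'}(x_0)+\sigma^{(t)}_{K,N'}(d(x_0,x_1))\rho_1^{-1/N'}(x_1)\Big]dq(x_0,x_1).$$ *)

theory Defs
  imports "HOL-Probability.Probability_Measure"
begin

text \<open>The class \<open>polish_space\<close> consists of the complete metric spaces that are second countable, which
  for metric spaces is the same as separable.\<close>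

definition metric_measure_space :: "'a::polish_space measure \<Rightarrow> bool" where
  "metric_measure_space m \<longleftrightarrow>
     sets m = sets borel \<and>
     (\<forall>x. \<forall>\<^sub>F r in at_right 0. emeasure m (ball x r) < \<infinity>)"

definition msupp :: "'a::topological_space measure \<Rightarrow> 'a set" where
  "msupp m = {x. \<forall>U. open U \<and> x \<in> U \<longrightarrow> emeasure m U > 0}"

definition P2 :: "'a::polish_space measure set" where
  "P2 = {\<nu>. prob_space \<nu> \<and> sets \<nu> = sets borel \<and>
            (\<exists>x0. (\<integral>\<^sup>+ x. ennreal ((dist x0 x)\<^sup>2) \<partial>\<nu>) < \<infinity>)}"

definition couplings :: "'a::polish_space measure \<Rightarrow> 'a measure \<Rightarrow> ('a \<times> 'a) measure set" where
  "couplings \<mu> \<nu> = {q. prob_space q \<and> sets q = sets (borel \<Otimes>\<^sub>M borel) \<and>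
                       distr q borel fst = \<mu> \<and> distr q borel snd = \<nu>}"

text \<open>Between measures in \<open>P2\<close> every coupling has finite cost, so the real-valued Bochner integral and
  infimum below carry no junk values there.\<close>

definition transport_cost :: "('a::polish_space \<times> 'a) measure \<Rightarrow> real" where
  "transport_cost q = (\<integral>(x, y). (dist x y)\<^sup>2 \<partial>q)"

definition W2 :: "'a::polish_space measure \<Rightarrow> 'a measure \<Rightarrow> real" where
  "W2 \<mu> \<nu> = (INF q\<in>couplings \<mu> \<nu>. sqrt (transport_cost q))"

definition optimal_coupling ::
    "('a::polish_space \<times> 'a) measure \<Rightarrow> 'a measure \<Rightarrow> 'a measure \<Rightarrow> bool" where
  "optimal_coupling q \<mu> \<nu> \<longleftrightarrow> q \<in> couplings \<mu> \<nu> \<and>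
     (\<forall>q'\<in>couplings \<mu> \<nu>. transport_cost q \<le> transport_cost q')"

definition P_infty :: "'a::polish_space measure \<Rightarrow> 'a measure set" where
  "P_infty m = {\<nu>\<in>P2. absolutely_continuous m \<nu> \<and> bounded (msupp \<nu>)}"

definition geodesic_in_P_infty :: "'a::polish_space measure \<Rightarrow> (real \<Rightarrow> 'a measure) \<Rightarrow> bool" where
  "geodesic_in_P_infty m \<Gamma> \<longleftrightarrow>
     (\<forall>t\<in>{0..1}. \<Gamma> t \<in> P_infty m) \<and>
     (\<forall>s\<in>{0..1}. \<forall>t\<in>{0..1}. W2 (\<Gamma> s) (\<Gamma> t) = \<bar>s - t\<bar> * W2 (\<Gamma> 0) (\<Gamma> 1))"

text \<open>For absolutely continuous probability measures the Radon-Nikodym derivative is finite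
  \<open>m\<close>-almost everywhere, so \<open>enn2real\<close> changes it on a null set only.\<close>

definition dens :: "'a measure \<Rightarrow> 'a measure \<Rightarrow> 'a \<Rightarrow> real" where
  "dens m \<nu> x = enn2real (RN_deriv m \<nu> x)"

text \<open>The entropy takes the value \<open>-\<infinity>\<close> when the integral diverges. Since \<open>0 powr a = 0\<close> for every \<open>a\<close>,
  the convention \<open>0\<^sup>0 = 0\<close> for \<open>N = 1\<close> is built in.\<close>

definition renyi_entropy :: "real \<Rightarrow> 'a measure \<Rightarrow> 'a measure \<Rightarrow> ereal" where
  "renyi_entropy N \<nu> m = - enn2ereal (\<integral>\<^sup>+ x. ennreal (dens m \<nu> x powr (1 - 1 / N)) \<partial>m)"

text \<open>Only meant for \<open>K > 0\<close>, \<open>N > 0\<close>, \<open>\<theta> \<ge> 0\<close> and \<open>0 \<le> t \<le> 1\<close>. Then the quotient is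
  nonnegative, so \<open>ennreal\<close> does not truncate it.\<close>

definition sigma_coeff :: "real \<Rightarrow> real \<Rightarrow> real \<Rightarrow> real \<Rightarrow> ennreal" where
  "sigma_coeff K N t \<theta> =
     (if K * \<theta>\<^sup>2 \<ge> N * pi\<^sup>2 then \<infinity>
      else if \<theta> = 0 then ennreal t
      else ennreal (sin (t * \<theta> * sqrt (K / N)) / sin (\<theta> * sqrt (K / N))))"

text \<open>The first (second) density vanishes on a null set of the first (second) marginal of \<open>q\<close> only, so
  the value of \<open>0 powr (- 1 / N')\<close> is irrelevant for the integral.\<close>

definition CD_star :: "real \<Rightarrow> real \<Rightarrow> 'a::polish_space measure \<Rightarrow> bool" where
  "CD_star K N m \<longleftrightarrow>
     (\<forall>\<nu>0\<in>P_infty m. \<forall>\<nu>1\<in>P_infty m.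
        \<exists>q \<Gamma>. optimal_coupling q \<nu>0 \<nu>1 \<and>
          geodesic_in_P_infty m \<Gamma> \<and> \<Gamma> 0 = \<nu>0 \<and> \<Gamma> 1 = \<nu>1 \<and>
          (\<forall>t\<in>{0..1}. \<forall>N'\<ge>N.
             renyi_entropy N' (\<Gamma> t) m \<le>
               - enn2ereal (\<integral>\<^sup>+ (x0, x1).
                   (sigma_coeff K N' (1 - t) (dist x0 x1) * ennreal (dens m \<nu>0 x0 powr (- 1 / N')) +
                    sigma_coeff K N' t (dist x0 x1) * ennreal (dens m \<nu>1 x1 powr (- 1 / N'))) \<partial>q)))"

end

theory Submission
  imports Defs
begin

text \<open>
  Apply the curvature-dimension condition to the normalized restrictions of \<open>m\<close> to a small ball
  \<open>ball x r\<close> around a point of the support and to a bounded set \<open>A\<close>. For small \<open>t\<close> the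
  intermediate measure \<open>\<Gamma> t\<close> still lives on \<open>ball x (2 * r)\<close>, so Jensen's inequality bounds its
  entropy by the mass of that ball, and a lower bound \<open>s\<close> for the distortion coefficient between
  \<open>ball x r\<close> and \<open>A\<close> yields \<open>s * m(A)\<^bsup>1/N\<^esup> \<le> m(ball x (2 * r))\<^bsup>1/N\<^esup>\<close>.
  If \<open>A\<close> is a small ball at distance greater than \<open>\<pi> * sqrt (N / K)\<close>, then \<open>s = \<infinity>\<close> is admissible,
  which is absurd; this bounds the diameter. In general \<open>s = t\<close> is admissible. With \<open>x\<close> fixed and
  \<open>A\<close> growing it shows that balls around points of the support have finite mass; with \<open>A\<close> fixed and
  \<open>x\<close> varying it bounds the mass of \<open>ball x (2 * r)\<close> from below uniformly, so a separated subset of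
  the support has boundedly many points.
\<close>

section \<open>Local finiteness and the support\<close>

lemma metric_measure_space_small_ball:
  assumes "metric_measure_space m"
  obtains R where "R > 0" "\<And>r. r \<le> R \<Longrightarrow> emeasure m (ball x r) < \<infinity>"
proof -
  have sets: "sets m = sets borel"
    using assms by (simp add: metric_measure_space_def)
  have "\<forall>\<^sub>F r in at_right 0. emeasure m (ball x r) < \<infinity>"
    using assms by (auto simp: metric_measure_space_def)
  then obtain b where b: "b > 0" "\<And>y. 0 < y \<Longrightarrow> y < b \<Longrightarrow> emeasure m (ball x y) < \<infinity>"
    unfolding eventually_at_right_field by auto
  show thesis
  proof (rule that[of "b / 2"])
    show "b / 2 > 0" using b by simp
    fix r :: real assume "r \<le> b / 2"
    then have "emeasure m (ball x r) \<le> emeasure m (ball x (b / 2))"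
      by (intro emeasure_mono) (auto simp: sets)
    also have "\<dots> < \<infinity>" using b by simp
    finally show "emeasure m (ball x r) < \<infinity>" .
  qed
qed

text \<open>The open sets of finite mass cover the space, and a countable subfamily already does so
  by second countability. Sigma-finiteness gives access to Radon-Nikodym derivatives.\<close>

lemma metric_measure_space_sigma_finite:
  fixes m :: "'a::polish_space measure"
  assumes "metric_measure_space m"
  shows "sigma_finite_measure m"
proof -
  have sets: "sets m = sets borel"
    using assms by (simp add: metric_measure_space_def)
  define F where "F = {U. open U \<and> emeasure m U < \<infinity>}"
  obtain F' where F': "F' \<subseteq> F" "countable F'" "\<Union>F' = \<Union>F"
    using Lindelof[of F] by (auto simp: F_def)
  have "x \<in> \<Union>F" for x
  proof -
    obtain R where "R > 0" "\<And>r. r \<le> R \<Longrightarrow> emeasure m (ball x r) < \<infinity>"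
      using metric_measure_space_small_ball[OF assms] by blast
    then have "ball x R \<in> F" "x \<in> ball x R" by (auto simp: F_def)
    then show ?thesis by blast
  qed
  then have "\<Union>F' = space m" using F' sets_eq_imp_space_eq[OF sets] by auto
  with F' show ?thesis
    by (intro sigma_finite_measure.intro exI[of _ F']) (auto simp: F_def sets less_top)
qed

lemma msupp_emeasure_ball_pos:
  assumes "x \<in> msupp m" "r > 0"
  shows "emeasure m (ball x r) > 0"
  using assms by (auto simp: msupp_def)

lemma closed_msupp: "closed (msupp m)"
proof -
  have "- msupp m = \<Union>{U. open U \<and> \<not> emeasure m U > 0}"
    by (auto simp: msupp_def)
  also have "open \<dots>" by auto
  finally show ?thesis by (simp add: closed_def)
qed

section \<open>Normalized restrictions of the reference measure\<close>

text \<open>These are the test measures fed into the curvature-dimension condition. Boundedness of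
  \<open>A\<close> yields both the finite second moment and the bounded support.\<close>

lemma uniform_measure_in_P_infty:
  fixes m :: "'a::polish_space measure"
  assumes m: "metric_measure_space m" and A: "A \<in> sets borel" "bounded A"
    and pos: "emeasure m A > 0" and fin: "emeasure m A < \<infinity>"
  shows "uniform_measure m A \<in> P_infty m"
proof -
  have sets: "sets m = sets borel"
    using m by (simp add: metric_measure_space_def)
  let ?u = "uniform_measure m A"
  interpret prob_space ?u
    using pos fin by (intro prob_space_uniform_measure) auto
  have AE: "AE x in ?u. x \<in> A"
    using A fin pos by (intro AE_uniform_measureI) (auto simp: sets)
  obtain x0 e where e: "\<And>x. x \<in> A \<Longrightarrow> dist x0 x \<le> e"
    using A(2) unfolding bounded_def by blast
  have "(\<integral>\<^sup>+ x. ennreal ((dist x0 x)\<^sup>2) \<partial>?u) \<le> (\<integral>\<^sup>+ x. ennreal (e\<^sup>2) \<partial>?u)"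
    using AE by (intro nn_integral_mono_AE) (auto elim!: eventually_mono simp: e intro!: ennreal_leI power_mono)
  also have "\<dots> < \<infinity>" using emeasure_space_1 by (simp)
  finally have P2: "?u \<in> P2"
    using prob_space_axioms sets by (auto simp: P2_def)
  have ac: "absolutely_continuous m ?u"
    unfolding uniform_measure_def using A sets
    by (intro absolutely_continuousI_density borel_measurable_divide_ennreal borel_measurable_indicator) auto
  \<comment> \<open>The set \<open>A\<close> is only Borel, so the support may leave
    \<open>A\<close> but not its closure.\<close>
  have "msupp ?u \<subseteq> closure A"
  proof
    fix x assume x: "x \<in> msupp ?u"
    show "x \<in> closure A"
    proof (rule ccontr)
      assume "x \<notin> closure A"
      then have "open (- closure A) \<and> x \<in> - closure A" by auto
      then have "emeasure ?u (- closure A) > 0" using x unfolding msupp_def by blast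
      moreover have "A \<inter> - closure A = {}" using closure_subset[of A] by auto
      then have "emeasure ?u (- closure A) = 0"
        using A by (subst emeasure_uniform_measure) (auto simp: sets)
      ultimately show False by simp
    qed
  qed
  then have "bounded (msupp ?u)"
    using A(2) bounded_closure bounded_subset by blast
  with P2 ac show ?thesis by (simp add: P_infty_def)
qed

text \<open>\<open>RN_deriv\<close> is an unspecified version of the density. Uniqueness identifies
  it with the explicit one up to an \<open>m\<close>-null set, which is also null for the
  restriction.\<close>

lemma AE_dens_uniform_measure:
  fixes m :: "'a::polish_space measure"
  assumes m: "metric_measure_space m" and A: "A \<in> sets borel"
    and pos: "emeasure m A > 0" and fin: "emeasure m A < \<infinity>"
  shows "AE x in uniform_measure m A. dens m (uniform_measure m A) x = 1 / measure m A"
proof -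
  have sets: "sets m = sets borel"
    using m by (simp add: metric_measure_space_def)
  interpret sigma_finite_measure m using m by (rule metric_measure_space_sigma_finite)
  have A': "A \<in> sets m" using A sets by simp
  have inv: "enn2real (inverse (emeasure m A)) = 1 / enn2real (emeasure m A)"
    using pos fin by (cases "emeasure m A") (auto simp: inverse_ennreal inverse_eq_divide)
  let ?f = "\<lambda>x. indicator A x / emeasure m A :: ennreal"
  have "AE x in m. ?f x = RN_deriv m (uniform_measure m A) x"
    using A' by (intro RN_deriv_unique) (auto simp: uniform_measure_def)
  then have 1: "AE x in m. x \<in> A \<longrightarrow> dens m (uniform_measure m A) x = 1 / measure m A"
  proof (rule eventually_mono)
    fix x assume *: "?f x = RN_deriv m (uniform_measure m A) x"
    show "x \<in> A \<longrightarrow> dens m (uniform_measure m A) x = 1 / measure m A"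
      unfolding dens_def *[symmetric]
      using inv by (auto simp: divide_ennreal_def measure_def)
  qed
  show ?thesis
    using fin pos by (intro AE_uniform_measureI A' 1)
qed

section \<open>Couplings and transport cost\<close>

lemma in_couplingsD:
  fixes q :: "('a::polish_space \<times> 'a) measure"
  assumes "q \<in> couplings \<mu> \<nu>"
  shows "prob_space q" "sets q = sets (borel \<Otimes>\<^sub>M borel)"
    "distr q borel fst = \<mu>" "distr q borel snd = \<nu>"
    "fst \<in> measurable q borel" "snd \<in> measurable q borel"
proof -
  show *: "prob_space q" "sets q = sets (borel \<Otimes>\<^sub>M borel)" "distr q borel fst = \<mu>" "distr q borel snd = \<nu>"
    using assms by (auto simp: couplings_def)
  show "fst \<in> measurable q borel" "snd \<in> measurable q borel"
    by (simp_all cong: measurable_cong_sets add: *(2))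
qed

lemma AE_coupling_fst:
  assumes q: "q \<in> couplings \<mu> \<nu>" and P: "AE x in \<mu>. P x"
  shows "AE z in q. P (fst z)"
  by (rule AE_distrD[OF in_couplingsD(5)[OF q]], subst in_couplingsD(3)[OF q], rule P)

lemma AE_coupling_snd:
  assumes q: "q \<in> couplings \<mu> \<nu>" and P: "AE x in \<nu>. P x"
  shows "AE z in q. P (snd z)"
  by (rule AE_distrD[OF in_couplingsD(6)[OF q]], subst in_couplingsD(4)[OF q], rule P)

text \<open>The infimum is attained at \<open>q\<close>. This turns the geodesic identity for
  \<open>W2\<close> into identities between costs.\<close>

lemma W2_optimal_coupling:
  assumes "optimal_coupling q \<mu> \<nu>"
  shows "(W2 \<mu> \<nu>)\<^sup>2 = transport_cost q"
proof -
  have nn: "transport_cost q \<ge> 0"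
    unfolding transport_cost_def by (intro integral_nonneg_AE) auto
  have "W2 \<mu> \<nu> = sqrt (transport_cost q)"
    unfolding W2_def using assms
    by (intro cInf_eq_minimum) (auto simp: optimal_coupling_def)
  with nn show ?thesis by simp
qed

text \<open>The triangle inequality through the centres \<open>a\<close> and \<open>b\<close>
  reduces the cost to the second moments of the marginals. Integrability ensures that
  \<open>transport_cost\<close> is a genuine integral and not the default value
  \<open>0\<close>.\<close>

lemma integrable_dist_coupling:
  fixes \<mu> \<nu> :: "'a::polish_space measure"
  assumes \<mu>: "\<mu> \<in> P2" and \<nu>: "\<nu> \<in> P2" and q: "q \<in> couplings \<mu> \<nu>"
  shows "integrable q (\<lambda>z. (dist (fst z) (snd z))\<^sup>2)"
proof -
  note [measurable_cong] = in_couplingsD(2)[OF q]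
  interpret prob_space q using q by (rule in_couplingsD)
  obtain a where a: "(\<integral>\<^sup>+ x. ennreal ((dist a x)\<^sup>2) \<partial>\<mu>) < \<infinity>" using \<mu> by (auto simp: P2_def)
  obtain b where b: "(\<integral>\<^sup>+ x. ennreal ((dist b x)\<^sup>2) \<partial>\<nu>) < \<infinity>" using \<nu> by (auto simp: P2_def)
  have ia: "integrable q (\<lambda>z. (dist a (fst z))\<^sup>2)"
  proof (rule integrableI_bounded)
    have "(\<integral>\<^sup>+ z. ennreal (norm ((dist a (fst z))\<^sup>2)) \<partial>q) = (\<integral>\<^sup>+ x. ennreal ((dist a x)\<^sup>2) \<partial>distr q borel fst)"
      by (subst nn_integral_distr) auto
    then show "(\<integral>\<^sup>+ z. ennreal (norm ((dist a (fst z))\<^sup>2)) \<partial>q) < \<infinity>" using a in_couplingsD(3)[OF q] by simp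
  qed measurable
  have ib: "integrable q (\<lambda>z. (dist b (snd z))\<^sup>2)"
  proof (rule integrableI_bounded)
    have "(\<integral>\<^sup>+ z. ennreal (norm ((dist b (snd z))\<^sup>2)) \<partial>q) = (\<integral>\<^sup>+ x. ennreal ((dist b x)\<^sup>2) \<partial>distr q borel snd)"
      by (subst nn_integral_distr) auto
    then show "(\<integral>\<^sup>+ z. ennreal (norm ((dist b (snd z))\<^sup>2)) \<partial>q) < \<infinity>" using b in_couplingsD(4)[OF q] by simp
  qed measurable
  have le: "(dist x y)\<^sup>2 \<le> 3 * ((dist a x)\<^sup>2 + (dist b y)\<^sup>2 + (dist a b)\<^sup>2)" for x y
  proof -
    have "dist x y \<le> dist a x + dist a b + dist b y"
      using dist_triangle[of x y b] dist_triangle[of x b a] by (simp add: dist_commute)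
    then have "(dist x y)\<^sup>2 \<le> (dist a x + dist a b + dist b y)\<^sup>2" by (intro power_mono) auto
    \<comment> \<open>The difference of the two sides is the sum of the squares of the three
      pairwise differences.\<close>
    also have "\<dots> \<le> 3 * ((dist a x)\<^sup>2 + (dist b y)\<^sup>2 + (dist a b)\<^sup>2)"
      using sum_squares_ge_zero[of "dist a x - dist a b" "dist b y - dist a b"]
        zero_le_square[of "dist a x - dist b y"]
      by (simp add: power2_eq_square algebra_simps)
    finally show ?thesis .
  qed
  show ?thesis
  proof (rule Bochner_Integration.integrable_bound)
    show "integrable q (\<lambda>z. 3 * ((dist a (fst z))\<^sup>2 + (dist b (snd z))\<^sup>2 + (dist a b)\<^sup>2))"
      using ia ib by auto
    show "(\<lambda>z. (dist (fst z) (snd z))\<^sup>2) \<in> borel_measurable q" by measurable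
    show "AE z in q. norm ((dist (fst z) (snd z))\<^sup>2)
      \<le> norm (3 * ((dist a (fst z))\<^sup>2 + (dist b (snd z))\<^sup>2 + (dist a b)\<^sup>2))"
      using le by (intro always_eventually allI order_trans[OF _ abs_ge_self[folded real_norm_def]]) simp
  qed
qed

section \<open>Approximate gluing of couplings and localization at small times\<close>

text \<open>Gluing exactly along a common marginal would call for a disintegration. Matching
  countably many labels only takes an explicit density with respect to the product measure.\<close>

lemma glue_over_nat:
  fixes P :: "'x measure" and Q :: "'y measure"
  assumes "prob_space P" "prob_space Q"
    and F [measurable]: "F \<in> measurable P (count_space (UNIV :: nat set))"
    and G [measurable]: "G \<in> measurable Q (count_space (UNIV :: nat set))"
    and FG: "\<And>i. emeasure P (F -` {i} \<inter> space P) = emeasure Q (G -` {i} \<inter> space Q)"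
  obtains R where "sets R = sets (P \<Otimes>\<^sub>M Q)" "distr R P fst = P" "distr R Q snd = Q"
    "AE z in R. F (fst z) = G (snd z)"
proof -
  interpret P: prob_space P by fact
  interpret Q: prob_space Q by fact
  interpret PQ: pair_sigma_finite P Q ..
  define w where "w i = emeasure P (F -` {i} \<inter> space P)" for i
  \<comment> \<open>The gluing makes \<open>P\<close> and \<open>Q\<close> independent conditionally on the common value of \<open>F\<close> and \<open>G\<close>.\<close>
  define h :: "'x \<times> 'y \<Rightarrow> ennreal" where
    "h z = (if F (fst z) = G (snd z) then inverse (w (F (fst z))) else 0)" for z
  have [measurable]: "w \<in> borel_measurable (count_space UNIV)" by simp
  \<comment> \<open>Equality of labels is a countable union of products of level sets.\<close>
  have [measurable]: "Measurable.pred (P \<Otimes>\<^sub>M Q) (\<lambda>z. F (fst z) = G (snd z))"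
  proof -
    have "Measurable.pred (P \<Otimes>\<^sub>M Q) (\<lambda>z. \<exists>i. F (fst z) = i \<and> G (snd z) = i)" by measurable
    moreover have "(\<lambda>z. \<exists>i. F (fst z) = i \<and> G (snd z) = i) = (\<lambda>z. F (fst z) = G (snd z))" by auto
    ultimately show ?thesis by simp
  qed
  have [measurable]: "h \<in> borel_measurable (P \<Otimes>\<^sub>M Q)" unfolding h_def by measurable
  define R where "R = density (P \<Otimes>\<^sub>M Q) h"
  have w_ne: "w i \<noteq> \<infinity>" for i unfolding w_def by simp
  have intQ: "(\<integral>\<^sup>+ y. h (x, y) \<partial>Q) = inverse (w (F x)) * w (F x)" for x
  proof -
    have "(\<integral>\<^sup>+ y. h (x, y) \<partial>Q) = (\<integral>\<^sup>+ y. inverse (w (F x)) * indicator (G -` {F x} \<inter> space Q) y \<partial>Q)"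
      by (intro nn_integral_cong) (auto simp: h_def indicator_def)
    also have "\<dots> = inverse (w (F x)) * w (F x)"
      by (subst nn_integral_cmult_indicator) (auto simp: w_def FG)
    finally show ?thesis .
  qed
  have intP: "(\<integral>\<^sup>+ x. h (x, y) \<partial>P) = inverse (w (G y)) * w (G y)" for y
  proof -
    have "(\<integral>\<^sup>+ x. h (x, y) \<partial>P) = (\<integral>\<^sup>+ x. inverse (w (G y)) * indicator (F -` {G y} \<inter> space P) x \<partial>P)"
      by (intro nn_integral_cong) (auto simp: h_def indicator_def)
    also have "\<dots> = inverse (w (G y)) * w (G y)"
      by (subst nn_integral_cmult_indicator) (auto simp: w_def)
    finally show ?thesis .
  qed
  \<comment> \<open>At a label of weight \<open>0\<close> the inner integral is
    \<open>inverse 0 * 0 = 0\<close> instead of \<open>1\<close>. There are countably many labels,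
    so the points carrying such a label form a null set.\<close>
  have null: "AE x in P. w (F x) \<noteq> 0"
  proof -
    have "AE x in P. \<forall>i. w i = 0 \<longrightarrow> F x \<noteq> i"
      by (subst AE_all_countable)
        (auto simp: w_def intro!: AE_I[where N="F -` {_} \<inter> space P"])
    then show ?thesis by eventually_elim auto
  qed
  have nullQ: "AE y in Q. w (G y) \<noteq> 0"
  proof -
    have "AE x in Q. \<forall>i. w i = 0 \<longrightarrow> G x \<noteq> i"
      by (subst AE_all_countable)
        (auto simp: w_def FG intro!: AE_I[where N="G -` {_} \<inter> space Q"])
    then show ?thesis by eventually_elim auto
  qed
  have one: "inverse (w i) * w i = 1" if "w i \<noteq> 0" for i
    using that w_ne[of i] by (simp add: ennreal_inverse_mult less_top mult.commute ennreal_divide_self flip: divide_ennreal_def)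
  show thesis
  proof (rule that)
    show setsR: "sets R = sets (P \<Otimes>\<^sub>M Q)" by (simp add: R_def)
    note [measurable_cong] = setsR
    show "distr R P fst = P"
    proof (rule measure_eqI)
      fix A assume "A \<in> sets (distr R P fst)"
      then have A [measurable]: "A \<in> sets P" by simp
      have "emeasure (distr R P fst) A = (\<integral>\<^sup>+ z. indicator A z \<partial>distr R P fst)" by simp
      also have "\<dots> = (\<integral>\<^sup>+ z. indicator A (fst z) \<partial>R)"
        by (rule nn_integral_distr) auto
      also have "\<dots> = (\<integral>\<^sup>+ z. h z * indicator A (fst z) \<partial>(P \<Otimes>\<^sub>M Q))"
        unfolding R_def by (subst nn_integral_density) auto
      also have "\<dots> = (\<integral>\<^sup>+ x. (\<integral>\<^sup>+ y. h (x, y) * indicator A x \<partial>Q) \<partial>P)"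
        by (subst Q.nn_integral_fst[symmetric]) auto
      also have "\<dots> = (\<integral>\<^sup>+ x. indicator A x \<partial>P)"
      proof (rule nn_integral_cong_AE)
        show "AE x in P. (\<integral>\<^sup>+ y. h (x, y) * indicator A x \<partial>Q) = indicator A x"
          using null AE_space
        proof eventually_elim
          fix x assume "w (F x) \<noteq> 0" and [measurable]: "x \<in> space P"
          then show "(\<integral>\<^sup>+ y. h (x, y) * indicator A x \<partial>Q) = indicator A x"
            by (subst nn_integral_multc) (auto simp: intQ one)
        qed
      qed
      finally show "emeasure (distr R P fst) A = emeasure P A" by simp
    qed simp
    show "distr R Q snd = Q"
    proof (rule measure_eqI)
      fix A assume "A \<in> sets (distr R Q snd)"
      then have A [measurable]: "A \<in> sets Q" by simp
      have "emeasure (distr R Q snd) A = (\<integral>\<^sup>+ z. indicator A z \<partial>distr R Q snd)" by simp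
      also have "\<dots> = (\<integral>\<^sup>+ z. indicator A (snd z) \<partial>R)"
        by (rule nn_integral_distr) auto
      also have "\<dots> = (\<integral>\<^sup>+ z. h z * indicator A (snd z) \<partial>(P \<Otimes>\<^sub>M Q))"
        unfolding R_def by (subst nn_integral_density) auto
      also have "\<dots> = (\<integral>\<^sup>+ y. (\<integral>\<^sup>+ x. h (x, y) * indicator A y \<partial>P) \<partial>Q)"
        by (subst PQ.nn_integral_snd[symmetric]) auto
      also have "\<dots> = (\<integral>\<^sup>+ y. indicator A y \<partial>Q)"
      proof (rule nn_integral_cong_AE)
        show "AE y in Q. (\<integral>\<^sup>+ x. h (x, y) * indicator A y \<partial>P) = indicator A y"
          using nullQ AE_space
        proof eventually_elim
          fix y assume "w (G y) \<noteq> 0" and [measurable]: "y \<in> space Q"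
          then show "(\<integral>\<^sup>+ x. h (x, y) * indicator A y \<partial>P) = indicator A y"
            by (subst nn_integral_multc) (auto simp: intP one)
        qed
      qed
      finally show "emeasure (distr R Q snd) A = emeasure Q A" by simp
    qed simp
    show "AE z in R. F (fst z) = G (snd z)"
      unfolding R_def by (subst AE_density) (auto simp: h_def)
  qed
qed

text \<open>The label of a point is the first index of a dense sequence whose member lies within
  \<open>\<delta> / 2\<close>; equal labels mean a common centre.\<close>

lemma countable_small_partition:
  fixes \<delta> :: real
  assumes "\<delta> > 0"
  obtains f :: "'a::polish_space \<Rightarrow> nat" where "f \<in> measurable borel (count_space UNIV)"
    "\<And>x y. f x = f y \<Longrightarrow> dist x y \<le> \<delta>"
proof -
  obtain D :: "'a set" where D: "countable D" "\<And>X. open X \<Longrightarrow> X \<noteq> {} \<Longrightarrow> \<exists>d\<in>D. d \<in> X"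
    using countable_dense_exists by blast
  have "D \<noteq> {}" using D(2)[of UNIV] by auto
  define d where "d = from_nat_into D"
  have ex: "\<exists>n. dist x (d n) < \<delta> / 2" for x
  proof -
    obtain y where "y \<in> D" "y \<in> ball x (\<delta> / 2)" using D(2)[of "ball x (\<delta>/2)"] assms by auto
    then show ?thesis
      using from_nat_into_surj[OF D(1), of y] by (auto simp: d_def)
  qed
  define f where "f x = (LEAST n. dist x (d n) < \<delta> / 2)" for x
  show thesis
  proof (rule that)
    show "f \<in> measurable borel (count_space UNIV)" unfolding f_def by measurable
    fix x y assume "f x = f y"
    moreover have "dist x (d (f x)) < \<delta> / 2" "dist y (d (f y)) < \<delta> / 2"
      unfolding f_def by (rule LeastI_ex[OF ex])+
    ultimately show "dist x y \<le> \<delta>"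
      using dist_triangle2[of x y "d (f x)"] by simp
  qed
qed

text \<open>
  The left-hand side gains \<open>1\<close> when the first leg \<open>a\<close> of a path with legs \<open>a\<close>, \<open>b\<close> is too long
  for time \<open>t\<close>. Integrated over glued couplings, with the gluing error \<open>\<delta>\<close> tending to \<open>0\<close>, this
  contradicts the geodesic property unless such paths have mass \<open>0\<close>.
\<close>

lemma split_cost_bound:
  fixes a b d t r E \<delta> :: real
  assumes "0 \<le> a" "0 \<le> b" "0 \<le> d" "0 \<le> \<delta>" "d \<le> a + b + \<delta>" "d \<le> E" "0 < t" "t < 1"
    and r: "0 < r" "t * (E\<^sup>2 + 1) \<le> r\<^sup>2"
  shows "(if r \<le> a then 1 else 0) + d\<^sup>2 - 2 * \<delta> * E \<le> a\<^sup>2 / t + b\<^sup>2 / (1 - t)"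
proof (cases "r \<le> a")
  case True
  \<comment> \<open>A long first leg alone pays at least \<open>E\<^sup>2 + 1\<close>, which exceeds
    \<open>d\<^sup>2\<close> by at least \<open>1\<close>.\<close>
  have "E\<^sup>2 + 1 \<le> r\<^sup>2 / t" using r assms(7) by (simp add: field_simps)
  also have "\<dots> \<le> a\<^sup>2 / t" using True r assms by (intro divide_right_mono power_mono) auto
  finally have "E\<^sup>2 + 1 \<le> a\<^sup>2 / t" .
  moreover have "d\<^sup>2 \<le> E\<^sup>2" using assms by (intro power_mono) auto
  moreover have "0 \<le> b\<^sup>2 / (1 - t)" using assms by simp
  moreover have "0 \<le> 2 * \<delta> * E" using assms by simp
  ultimately have "1 + d\<^sup>2 - 2 * \<delta> * E \<le> a\<^sup>2 / t + b\<^sup>2 / (1 - t)" by linarith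
  then show ?thesis using True by simp
next
  case False
  \<comment> \<open>Weighted Cauchy-Schwarz inequality, with equality when the legs are in
    proportion \<open>t\<close> to \<open>1 - t\<close>.\<close>
  have "a\<^sup>2 / t + b\<^sup>2 / (1 - t) - (a + b)\<^sup>2 = ((1 - t) * a - t * b)\<^sup>2 / (t * (1 - t))"
    using assms(7,8) by (simp add: divide_simps) (simp add: power2_eq_square algebra_simps)
  also have "\<dots> \<ge> 0" using assms(7,8) by simp
  finally have 1: "(a + b)\<^sup>2 \<le> a\<^sup>2 / t + b\<^sup>2 / (1 - t)" by simp
  have \<delta>E: "\<delta> * d \<le> \<delta> * E" "0 \<le> \<delta> * E" using assms by (auto intro: mult_left_mono)
  \<comment> \<open>The bound \<open>d - \<delta> \<le> a + b\<close> can be squared only if its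
    left side is nonnegative, hence the case distinction.\<close>
  have "d\<^sup>2 - 2 * \<delta> * E \<le> (a + b)\<^sup>2"
  proof (cases "d \<le> \<delta>")
    case True
    have "d\<^sup>2 \<le> \<delta> * d" using True assms(3) by (simp add: power2_eq_square mult_right_mono)
    then have "d\<^sup>2 - 2 * \<delta> * E \<le> 0" using \<delta>E by linarith
    then show ?thesis using zero_le_power2[of "a + b"] by linarith
  next
    case False
    have "(d - \<delta>)\<^sup>2 \<le> (a + b)\<^sup>2" using False assms by (intro power_mono) auto
    moreover have "(d - \<delta>)\<^sup>2 = d\<^sup>2 - 2 * (\<delta> * d) + \<delta>\<^sup>2" by (simp add: power2_eq_square algebra_simps)
    ultimately show ?thesis using \<delta>E zero_le_power2[of \<delta>] by linarith
  qed
  with 1 False show ?thesis by simp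
qed

text \<open>Gluing \<open>q1\<close> and \<open>q2\<close> along cells of small diameter produces a
  competitor between \<open>\<mu>0\<close> and \<open>\<mu>1\<close>. If long first legs had
  positive mass, this competitor would be cheaper than \<open>cost\<close> allows.\<close>

lemma intermediate_dist_less:
  fixes \<mu>0 \<mu>t \<mu>1 :: "'a::polish_space measure"
  assumes q1: "q1 \<in> couplings \<mu>0 \<mu>t" and q2: "q2 \<in> couplings \<mu>t \<mu>1"
    and i1: "integrable q1 (\<lambda>z. (dist (fst z) (snd z))\<^sup>2)"
    and i2: "integrable q2 (\<lambda>z. (dist (fst z) (snd z))\<^sup>2)"
    and A0: "AE x in \<mu>0. x \<in> A0" and A1: "AE x in \<mu>1. x \<in> A1"
    and E: "\<And>x y. x \<in> A0 \<Longrightarrow> y \<in> A1 \<Longrightarrow> dist x y \<le> E" "0 \<le> E"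
    and t: "0 < t" "t < 1"
    and cost: "\<And>q. q \<in> couplings \<mu>0 \<mu>1 \<Longrightarrow>
      transport_cost q1 / t + transport_cost q2 / (1 - t) \<le> transport_cost q"
    and r: "0 < r" "t * (E\<^sup>2 + 1) \<le> r\<^sup>2"
  shows "AE z in q1. dist (fst z) (snd z) < r"
proof -
  note [measurable_cong] = in_couplingsD(2)[OF q1] in_couplingsD(2)[OF q2]
  interpret q1: prob_space q1 using q1 by (rule in_couplingsD)
  interpret q2: prob_space q2 using q2 by (rule in_couplingsD)
  define u where "u z = (dist (fst z) (snd z))\<^sup>2" for z :: "'a \<times> 'a"
  have u[measurable]: "u \<in> borel_measurable (borel \<Otimes>\<^sub>M borel)" unfolding u_def by measurable
  have tc: "transport_cost q = (\<integral>z. u z \<partial>q)" for q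
    by (simp add: transport_cost_def u_def case_prod_unfold)
  define B where "B = {z \<in> space q1. r \<le> dist (fst z) (snd z)}"
  have B[measurable]: "B \<in> sets q1" unfolding B_def by measurable
  \<comment> \<open>The competitor cannot undercut the left side of \<open>cost\<close>, so the gain
    on \<open>B\<close> is at most the gluing error \<open>2 * \<delta> * E\<close>.\<close>
  have bound: "measure q1 B \<le> 2 * \<delta> * E" if "\<delta> > 0" for \<delta>
  proof -
    obtain f :: "'a \<Rightarrow> nat" where f[measurable]: "f \<in> measurable borel (count_space UNIV)"
      and f\<delta>: "\<And>x y. f x = f y \<Longrightarrow> dist x y \<le> \<delta>"
      using countable_small_partition[OF \<open>\<delta> > 0\<close>] by blast
    have e1: "emeasure q1 ((\<lambda>z. f (snd z)) -` {i} \<inter> space q1) = emeasure \<mu>t (f -` {i})" for i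
    proof -
      have "emeasure (distr q1 borel snd) (f -` {i}) = emeasure q1 (snd -` (f -` {i}) \<inter> space q1)"
        using measurable_sets[OF f, of "{i}"] by (intro emeasure_distr) auto
      then show ?thesis by (simp only: in_couplingsD(4)[OF q1] vimage_def) (simp add: vimage_def)
    qed
    have e2: "emeasure q2 ((\<lambda>z. f (fst z)) -` {i} \<inter> space q2) = emeasure \<mu>t (f -` {i})" for i
    proof -
      have "emeasure (distr q2 borel fst) (f -` {i}) = emeasure q2 (fst -` (f -` {i}) \<inter> space q2)"
        using measurable_sets[OF f, of "{i}"] by (intro emeasure_distr) auto
      then show ?thesis by (simp only: in_couplingsD(3)[OF q2] vimage_def) (simp add: vimage_def)
    qed
    obtain R where setsR: "sets R = sets (q1 \<Otimes>\<^sub>M q2)" and R1: "distr R q1 fst = q1"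
      and R2: "distr R q2 snd = q2" and Rf: "AE z in R. f (snd (fst z)) = f (fst (snd z))"
      by (rule glue_over_nat[of q1 q2 "\<lambda>z. f (snd z)" "\<lambda>z. f (fst z)"])
        (simp_all add: q1.prob_space_axioms q2.prob_space_axioms e1 e2)
    note [measurable_cong] = setsR
    have mfst[measurable]: "fst \<in> measurable R q1" and msnd[measurable]: "snd \<in> measurable R q2" by measurable
    interpret R: prob_space R
      using q1.prob_space_axioms prob_space_distrD[OF mfst] R1 by simp
    \<comment> \<open>Only the two ends of a glued path are kept, so \<open>\<pi>\<close> has the
      exact marginals although the middle points agree only up to \<open>\<delta>\<close>.\<close>
    define g :: "('a \<times> 'a) \<times> 'a \<times> 'a \<Rightarrow> 'a \<times> 'a" where "g z = (fst (fst z), snd (snd z))" for z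
    have g[measurable]: "g \<in> measurable R (borel \<Otimes>\<^sub>M borel)" unfolding g_def by measurable
    define \<pi> where "\<pi> = distr R (borel \<Otimes>\<^sub>M borel) g"
    have "distr \<pi> borel fst = distr (distr R q1 fst) borel fst"
      unfolding \<pi>_def by (subst (1 2) distr_distr) (auto simp: g_def comp_def)
    then have \<pi>1: "distr \<pi> borel fst = \<mu>0" by (simp only: R1 in_couplingsD(3)[OF q1])
    have "distr \<pi> borel snd = distr (distr R q2 snd) borel snd"
      unfolding \<pi>_def by (subst (1 2) distr_distr) (auto simp: g_def comp_def)
    then have \<pi>2: "distr \<pi> borel snd = \<mu>1" by (simp only: R2 in_couplingsD(4)[OF q2])
    have \<pi>: "\<pi> \<in> couplings \<mu>0 \<mu>1"
      using \<pi>1 \<pi>2 by (auto simp: couplings_def \<pi>_def intro: R.prob_space_distr)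
    have AE0: "AE z in R. fst (fst z) \<in> A0"
      by (rule AE_distrD[OF mfst], subst R1, rule AE_coupling_fst[OF q1 A0])
    have AE1: "AE z in R. snd (snd z) \<in> A1"
      by (rule AE_distrD[OF msnd], subst R2, rule AE_coupling_snd[OF q2 A1])
    have I1: "integrable R (\<lambda>z. u (fst z))"
      using i1 R1 by (subst integrable_distr_eq[OF mfst, symmetric]) (simp_all add: u_def[abs_def])
    have I2: "integrable R (\<lambda>z. u (snd z))"
      using i2 R2 by (subst integrable_distr_eq[OF msnd, symmetric]) (simp_all add: u_def[abs_def])
    have J1: "(\<integral>z. u (fst z) \<partial>R) = transport_cost q1"
      unfolding tc using integral_distr[OF mfst, of u] by (simp add: R1)
    have J2: "(\<integral>z. u (snd z) \<partial>R) = transport_cost q2"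
      unfolding tc using integral_distr[OF msnd, of u] by (simp add: R2)
    have J3: "(\<integral>z. u (g z) \<partial>R) = transport_cost \<pi>"
      unfolding tc \<pi>_def by (subst integral_distr) auto
    have J4: "(\<integral>z. indicator B (fst z) \<partial>R) = measure q1 B"
      using integral_distr[OF mfst, of "indicator B :: _ \<Rightarrow> real"] by (simp add: R1 B)
    have ug: "AE z in R. norm (u (g z)) \<le> E\<^sup>2"
      using AE0 AE1 by eventually_elim (auto simp: u_def g_def intro!: power_mono E)
    have I3: "integrable R (\<lambda>z. u (g z))"
      using ug by (intro R.integrable_const_bound) measurable
    have I4: "integrable R (\<lambda>z. indicator B (fst z) :: real)"
      by (intro R.integrable_const_bound[where B=1]) auto
    have "(\<integral>z. indicator B (fst z) + u (g z) - 2 * \<delta> * E \<partial>R) \<le> (\<integral>z. u (fst z) / t + u (snd z) / (1 - t) \<partial>R)"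
    proof (rule integral_mono_AE)
      show "AE z in R. indicator B (fst z) + u (g z) - 2 * \<delta> * E \<le> u (fst z) / t + u (snd z) / (1 - t)"
        using AE0 AE1 Rf
      proof eventually_elim
        fix z assume z: "fst (fst z) \<in> A0" "snd (snd z) \<in> A1" "f (snd (fst z)) = f (fst (snd z))"
        let ?a = "dist (fst (fst z)) (snd (fst z))" and ?b = "dist (fst (snd z)) (snd (snd z))"
          and ?d = "dist (fst (fst z)) (snd (snd z))"
        \<comment> \<open>Triangle inequality through both middle points, which carry the same
          label.\<close>
        have "?d \<le> ?a + ?b + \<delta>"
          using f\<delta>[OF z(3)] dist_triangle[of "fst (fst z)" "snd (snd z)" "snd (fst z)"]
            dist_triangle[of "snd (fst z)" "snd (snd z)" "fst (snd z)"] by linarith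
        then have *: "(if r \<le> ?a then 1 else 0) + ?d\<^sup>2 - 2 * \<delta> * E \<le> ?a\<^sup>2 / t + ?b\<^sup>2 / (1 - t)"
          using that t r E(1)[OF z(1,2)] by (intro split_cost_bound) auto
        have "indicator B (fst z) \<le> (if r \<le> ?a then 1 else 0 :: real)"
          by (auto simp: B_def indicator_def)
        with * show "indicator B (fst z) + u (g z) - 2 * \<delta> * E \<le> u (fst z) / t + u (snd z) / (1 - t)"
          by (simp add: u_def g_def)
      qed
    qed (use I1 I2 I3 I4 in auto)
    then have "measure q1 B + transport_cost \<pi> - 2 * \<delta> * E \<le> transport_cost q1 / t + transport_cost q2 / (1 - t)"
      using I1 I2 I3 I4 by (simp add: J1 J2 J3 J4 R.prob_space)
    with cost[OF \<pi>] show ?thesis by linarith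
  qed
  have "measure q1 B \<le> 0"
  proof (rule field_le_epsilon)
    fix e :: real assume "e > 0"
    \<comment> \<open>The mesh is chosen so that the error is at most \<open>e\<close>; the summand
      \<open>1\<close> keeps the denominator positive when \<open>E = 0\<close>.\<close>
    then have "measure q1 B \<le> 2 * (e / (2 * (E + 1))) * E" using E by (intro bound) auto
    also have "\<dots> = e * (E / (E + 1))" using E(2) by (simp add: field_simps)
    also have "\<dots> \<le> e * 1" using E(2) \<open>e > 0\<close> by (intro mult_left_mono) auto
    finally show "measure q1 B \<le> 0 + e" by simp
  qed
  then have "AE z in q1. z \<notin> B"
    using q1.prob_eq_0[OF B] by (simp add: antisym)
  then show ?thesis
    using AE_space by eventually_elim (auto simp: B_def)
qed

section \<open>Entropy estimate and the basic mass inequality\<close>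

text \<open>Jensen's inequality in tangent form: among absolutely continuous probability measures on
  \<open>B\<close>, the uniform one has the largest integral. The tangent is integrated instead of
  the power.\<close>

lemma nn_integral_dens_powr_le:
  fixes m \<nu> :: "'a measure"
  assumes "sigma_finite_measure m" "prob_space \<nu>" and sets: "sets \<nu> = sets m"
    and ac: "absolutely_continuous m \<nu>" and B: "B \<in> sets m" "emeasure m B < \<infinity>"
    and AEB: "AE x in \<nu>. x \<in> B" and N: "N \<ge> 1"
  shows "(\<integral>\<^sup>+ x. ennreal (dens m \<nu> x powr (1 - 1 / N)) \<partial>m) \<le> ennreal (measure m B powr (1 / N))"
proof -
  interpret m: sigma_finite_measure m by fact
  interpret \<nu>: prob_space \<nu> by fact
  have dens: "density m (RN_deriv m \<nu>) = \<nu>" using ac sets by (rule m.density_RN_deriv)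
  have fin: "AE x in m. RN_deriv m \<nu> x \<noteq> \<infinity>"
    using \<nu>.sigma_finite_measure_axioms ac sets by (rule m.RN_deriv_finite)
  have B0: "AE x in m. 0 < RN_deriv m \<nu> x \<longrightarrow> x \<in> B"
    using AEB by (subst (asm) dens[symmetric]) (simp add: AE_density)
  define c where "c = measure m B"
  have emB: "emeasure m B = ennreal c"
    unfolding c_def using B by (intro emeasure_eq_ennreal_measure) auto
  have "emeasure m B \<noteq> 0"
  proof
    assume "emeasure m B = 0"
    then have "B \<in> null_sets \<nu>" using ac B by (auto simp: absolutely_continuous_def null_sets_def)
    then have "AE x in \<nu>. x \<notin> B" by (rule AE_not_in)
    with AEB have "AE x in \<nu>. False" by eventually_elim auto
    then show False using \<nu>.AE_False by simp
  qed
  then have c: "c > 0" using emB by (cases "c > 0") (auto simp: ennreal_neg)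
  define \<alpha> where "\<alpha> = 1 - 1 / N"
  have \<alpha>: "0 \<le> \<alpha>" "\<alpha> + 1 / N = 1" using N by (auto simp: \<alpha>_def)
  \<comment> \<open>The tangent of the concave function \<open>v powr \<alpha>\<close> at \<open>v = 1 / c\<close>, the density of the uniform measure on \<open>B\<close>.\<close>
  have young: "v powr \<alpha> \<le> c powr (1 / N) * (\<alpha> * v + 1 / (N * c))" if "v > 0" for v :: real
  proof -
    have "v powr \<alpha> * (1 / c) powr (1 / N) \<le> \<alpha> * v + 1 / N * (1 / c)"
      using that c N \<alpha> by (intro Youngs_inequality_0) auto
    then have "c powr (1 / N) * (v powr \<alpha> * (1 / c) powr (1 / N)) \<le> c powr (1 / N) * (\<alpha> * v + 1 / (N * c))"
      by (intro mult_left_mono) auto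
    moreover have "c powr (1 / N) * (1 / c) powr (1 / N) = 1"
      using c by (simp flip: powr_mult)
    ultimately show ?thesis by (simp add: mult.left_commute)
  qed
  have "(\<integral>\<^sup>+ x. ennreal (dens m \<nu> x powr \<alpha>) \<partial>m) \<le>
    (\<integral>\<^sup>+ x. ennreal (c powr (1 / N)) * (ennreal \<alpha> * RN_deriv m \<nu> x + ennreal (1 / (N * c)) * indicator B x) \<partial>m)"
  proof (rule nn_integral_mono_AE)
    show "AE x in m. ennreal (dens m \<nu> x powr \<alpha>) \<le>
      ennreal (c powr (1 / N)) * (ennreal \<alpha> * RN_deriv m \<nu> x + ennreal (1 / (N * c)) * indicator B x)"
      using fin B0
    proof eventually_elim
      fix x assume x: "RN_deriv m \<nu> x \<noteq> \<infinity>" "0 < RN_deriv m \<nu> x \<longrightarrow> x \<in> B"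
      obtain v where v: "RN_deriv m \<nu> x = ennreal v" "v \<ge> 0" using x(1) by (cases "RN_deriv m \<nu> x") auto
      show "ennreal (dens m \<nu> x powr \<alpha>) \<le>
        ennreal (c powr (1 / N)) * (ennreal \<alpha> * RN_deriv m \<nu> x + ennreal (1 / (N * c)) * indicator B x)"
      proof (cases "v > 0")
        case True
        then have "x \<in> B" using x v by (simp add: ennreal_less_zero_iff)
        then show ?thesis
          using young[OF True] v \<alpha> c N
          by (simp add: dens_def flip: ennreal_mult ennreal_plus)
      next
        \<comment> \<open>For \<open>N = 1\<close> the exponent is \<open>0\<close>, and the
          convention \<open>0 powr 0 = 0\<close> is what makes this case work.\<close>
        case False
        then have "v = 0" using v by simp
        then show ?thesis using v by (simp add: dens_def)
      qed
    qed
  qed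
  also have "\<dots> = ennreal (c powr (1 / N)) * (ennreal \<alpha> * (\<integral>\<^sup>+ x. RN_deriv m \<nu> x \<partial>m) + ennreal (1 / (N * c)) * emeasure m B)"
    using B by (simp add: nn_integral_cmult nn_integral_add nn_integral_cmult_indicator)
  also have "(\<integral>\<^sup>+ x. RN_deriv m \<nu> x \<partial>m) = emeasure (density m (RN_deriv m \<nu>)) (space m)"
    by (subst emeasure_density) (auto intro!: nn_integral_cong)
  also have "\<dots> = 1" using \<nu>.emeasure_space_1 sets_eq_imp_space_eq[OF sets] by (simp add: dens)
  also have "ennreal (c powr (1 / N)) * (ennreal \<alpha> * 1 + ennreal (1 / (N * c)) * emeasure m B) = ennreal (c powr (1 / N))"
    unfolding emB using c \<alpha> N by (simp flip: ennreal_mult ennreal_plus)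
  finally show ?thesis by (simp add: \<alpha>_def c_def)
qed

text \<open>Common source of the diameter bound and the volume comparison. The conditions on
  \<open>t\<close> keep the intermediate measure in \<open>ball x (2 * r)\<close>; \<open>s\<close>
  is an extended number so that \<open>\<infinity>\<close> can be inserted.\<close>

lemma CD_star_mass_bound:
  fixes m :: "'a::polish_space measure"
  assumes N: "N \<ge> 1" and m: "metric_measure_space m" and CD: "CD_star K N m"
    and r: "r > 0" and x: "x \<in> msupp m" and fin: "emeasure m (ball x (2 * r)) < \<infinity>"
    and A: "A \<in> sets borel" "bounded A" "0 < emeasure m A" "emeasure m A < \<infinity>"
    and E: "\<And>a b. a \<in> ball x r \<Longrightarrow> b \<in> A \<Longrightarrow> dist a b \<le> E" "0 \<le> E"
    and t: "0 < t" "t < 1" "t * (E\<^sup>2 + 1) \<le> r\<^sup>2"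
    and s: "\<And>a b. a \<in> ball x r \<Longrightarrow> b \<in> A \<Longrightarrow> s \<le> sigma_coeff K N t (dist a b)"
  shows "s * ennreal (measure m A powr (1 / N)) \<le> ennreal (measure m (ball x (2 * r)) powr (1 / N))"
proof -
  have sets: "sets m = sets borel"
    using m by (simp add: metric_measure_space_def)
  have sfin: "sigma_finite_measure m" using m by (rule metric_measure_space_sigma_finite)
  let ?A0 = "ball x r"
  define \<nu>0 where "\<nu>0 = uniform_measure m ?A0"
  define \<nu>1 where "\<nu>1 = uniform_measure m A"
  have A0: "0 < emeasure m ?A0" "emeasure m ?A0 < \<infinity>"
  proof -
    show "0 < emeasure m ?A0" using x r by (rule msupp_emeasure_ball_pos)
    have "emeasure m ?A0 \<le> emeasure m (ball x (2 * r))"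
      using r by (intro emeasure_mono) (auto simp: sets)
    with fin show "emeasure m ?A0 < \<infinity>" by (rule order.strict_trans1[rotated])
  qed
  have \<nu>0: "\<nu>0 \<in> P_infty m" unfolding \<nu>0_def using m A0 by (intro uniform_measure_in_P_infty) auto
  have \<nu>1: "\<nu>1 \<in> P_infty m" unfolding \<nu>1_def using m A by (intro uniform_measure_in_P_infty) auto
  have AE0: "AE y in \<nu>0. y \<in> ?A0"
    unfolding \<nu>0_def using A0 by (intro AE_uniform_measureI) (auto simp: sets)
  have AE1: "AE y in \<nu>1. y \<in> A"
    unfolding \<nu>1_def using A by (intro AE_uniform_measureI) (auto simp: sets)
  obtain q \<Gamma> where q: "optimal_coupling q \<nu>0 \<nu>1" and geo: "geodesic_in_P_infty m \<Gamma>"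
    and \<Gamma>: "\<Gamma> 0 = \<nu>0" "\<Gamma> 1 = \<nu>1"
    and ent: "\<forall>t\<in>{0..1}. \<forall>N'\<ge>N. renyi_entropy N' (\<Gamma> t) m \<le>
               - enn2ereal (\<integral>\<^sup>+ (x0, x1).
                   (sigma_coeff K N' (1 - t) (dist x0 x1) * ennreal (dens m \<nu>0 x0 powr (- 1 / N')) +
                    sigma_coeff K N' t (dist x0 x1) * ennreal (dens m \<nu>1 x1 powr (- 1 / N'))) \<partial>q)"
    using CD \<nu>0 \<nu>1 unfolding CD_star_def by blast
  have t01: "t \<in> {0..1}" using t by auto
  have \<Gamma>t: "\<Gamma> t \<in> P_infty m" using geo t01 by (auto simp: geodesic_in_P_infty_def)
  \<comment> \<open>The curvature-dimension condition itself supplies optimal couplings, also for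
    the two halves of the geodesic.\<close>
  have optimal: "\<exists>q. optimal_coupling q \<mu> \<nu>" if "\<mu> \<in> P_infty m" "\<nu> \<in> P_infty m" for \<mu> \<nu>
    using CD that unfolding CD_star_def by blast
  obtain q1 where q1: "optimal_coupling q1 \<nu>0 (\<Gamma> t)" using optimal \<nu>0 \<Gamma>t by blast
  obtain q2 where q2: "optimal_coupling q2 (\<Gamma> t) \<nu>1" using optimal \<nu>1 \<Gamma>t by blast
  have couplings: "q \<in> couplings \<nu>0 \<nu>1" "q1 \<in> couplings \<nu>0 (\<Gamma> t)" "q2 \<in> couplings (\<Gamma> t) \<nu>1"
    using q q1 q2 by (auto simp: optimal_coupling_def)
  have P2: "\<nu>0 \<in> P2" "\<nu>1 \<in> P2" "\<Gamma> t \<in> P2" using \<nu>0 \<nu>1 \<Gamma>t by (auto simp: P_infty_def)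

  have W2: "W2 (\<Gamma> s) (\<Gamma> t') = \<bar>s - t'\<bar> * W2 (\<Gamma> 0) (\<Gamma> 1)" if "s \<in> {0..1}" "t' \<in> {0..1}" for s t'
    using geo that by (simp only: geodesic_in_P_infty_def)
  have "W2 (\<Gamma> 0) (\<Gamma> t) = \<bar>0 - t\<bar> * W2 (\<Gamma> 0) (\<Gamma> 1)" "W2 (\<Gamma> t) (\<Gamma> 1) = \<bar>t - 1\<bar> * W2 (\<Gamma> 0) (\<Gamma> 1)"
    by (rule W2; use t01 in simp)+
  then have "transport_cost q1 = t\<^sup>2 * transport_cost q" "transport_cost q2 = (1 - t)\<^sup>2 * transport_cost q"
    using t by (simp_all add: \<Gamma> power_mult_distrib
      flip: W2_optimal_coupling[OF q] W2_optimal_coupling[OF q1] W2_optimal_coupling[OF q2])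
  \<comment> \<open>Division by \<open>t\<close> and \<open>1 - t\<close> leaves the fractions
    \<open>t\<close> and \<open>1 - t\<close> of the total cost, which add up to it.\<close>
  then have cost: "transport_cost q1 / t + transport_cost q2 / (1 - t) = transport_cost q"
    using t by (simp add: power2_eq_square) (simp add: algebra_simps)
  have "AE z in q1. dist (fst z) (snd z) < r"
  proof (rule intermediate_dist_less[OF couplings(2,3) _ _ AE0 AE1 E(1) E(2) t(1,2) _ r t(3)])
    show "integrable q1 (\<lambda>z. (dist (fst z) (snd z))\<^sup>2)" "integrable q2 (\<lambda>z. (dist (fst z) (snd z))\<^sup>2)"
      using P2 couplings by (auto intro: integrable_dist_coupling)
    show "transport_cost q1 / t + transport_cost q2 / (1 - t) \<le> transport_cost q'"
      if "q' \<in> couplings \<nu>0 \<nu>1" for q'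
      unfolding cost using that q by (auto simp: optimal_coupling_def)
  qed
  then have "AE z in q1. snd z \<in> ball x (2 * r)"
    using AE_coupling_fst[OF couplings(2) AE0]
  proof eventually_elim
    case (elim z)
    then show ?case using dist_triangle[of x "snd z" "fst z"] by simp
  qed
  then have "AE y in distr q1 borel snd. y \<in> ball x (2 * r)"
    by (subst AE_distr_iff[OF in_couplingsD(6)[OF couplings(2)]]) auto
  then have conc: "AE y in \<Gamma> t. y \<in> ball x (2 * r)"
    by (simp only: in_couplingsD(4)[OF couplings(2)])
  have upper: "(\<integral>\<^sup>+ y. ennreal (dens m (\<Gamma> t) y powr (1 - 1 / N)) \<partial>m)
      \<le> ennreal (measure m (ball x (2 * r)) powr (1 / N))"
    using \<Gamma>t sfin N fin conc
    by (intro nn_integral_dens_powr_le) (auto simp: P_infty_def P2_def sets)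

  let ?I = "\<integral>\<^sup>+ (x0, x1).
     (sigma_coeff K N (1 - t) (dist x0 x1) * ennreal (dens m \<nu>0 x0 powr (- 1 / N)) +
      sigma_coeff K N t (dist x0 x1) * ennreal (dens m \<nu>1 x1 powr (- 1 / N))) \<partial>q"
  interpret q: prob_space q using couplings(1) by (rule in_couplingsD)
  have cA: "measure m A > 0"
    using A by (simp add: measure_def enn2real_positive_iff)
  have "s * ennreal (measure m A powr (1 / N)) = (\<integral>\<^sup>+ z. s * ennreal (measure m A powr (1 / N)) \<partial>q)"
    using q.emeasure_space_1 by simp
  also have "\<dots> \<le> ?I"
  proof (rule nn_integral_mono_AE)
    have "AE y in \<nu>1. dens m \<nu>1 y = 1 / measure m A"
      unfolding \<nu>1_def using m A by (intro AE_dens_uniform_measure)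
    from AE_coupling_snd[OF couplings(1) this] AE_coupling_fst[OF couplings(1) AE0]
      AE_coupling_snd[OF couplings(1) AE1]
    show "AE z in q. s * ennreal (measure m A powr (1 / N)) \<le>
      (case z of (x0, x1) \<Rightarrow>
        sigma_coeff K N (1 - t) (dist x0 x1) * ennreal (dens m \<nu>0 x0 powr (- 1 / N)) +
        sigma_coeff K N t (dist x0 x1) * ennreal (dens m \<nu>1 x1 powr (- 1 / N)))"
    proof eventually_elim
      case (elim z)
      have "dens m \<nu>1 (snd z) powr (- 1 / N) = measure m A powr (1 / N)"
        using cA by (simp add: elim powr_divide powr_minus_divide)
      then have "s * ennreal (measure m A powr (1 / N)) \<le>
         sigma_coeff K N t (dist (fst z) (snd z)) * ennreal (dens m \<nu>1 (snd z) powr (- 1 / N))"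
        using s[of "fst z" "snd z"] elim by (simp add: mult_right_mono)
      \<comment> \<open>The distortion term of \<open>\<nu>0\<close> is nonnegative and is
        dropped.\<close>
      then show ?case
        by (simp add: case_prod_unfold add_increasing)
    qed
  qed
  \<comment> \<open>The entropy inequality for \<open>N' = N\<close>; both sides are negated
    integrals, so the order is reversed.\<close>
  also have "?I \<le> (\<integral>\<^sup>+ y. ennreal (dens m (\<Gamma> t) y powr (1 - 1 / N)) \<partial>m)"
    using ent t01 by (auto simp: renyi_entropy_def less_eq_ennreal.rep_eq)
  also note upper
  finally show ?thesis .
qed

section \<open>Distortion coefficients and the diameter bound\<close>

lemma sin_mult_ge:
  assumes t: "0 \<le> t" "t \<le> 1" and \<alpha>: "0 \<le> \<alpha>" "\<alpha> \<le> pi"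
  shows "t * sin \<alpha> \<le> sin (t * \<alpha>)"
proof -
  have "convex_on {0..pi} (\<lambda>x. - sin x)"
    by (rule f''_ge0_imp_convex[where f' = "\<lambda>x. - cos x" and f'' = "\<lambda>x. sin x"])
      (auto intro!: derivative_eq_intros sin_ge_zero)
  from convex_onD[OF this t, of 0 \<alpha>] \<alpha> show ?thesis by simp
qed

text \<open>The value \<open>t\<close> is the coefficient of flat space. Below the threshold,
  concavity of the sine on \<open>{0..pi}\<close> shows that positive \<open>K\<close> can only
  increase it.\<close>

lemma sigma_coeff_ge:
  assumes K: "K > 0" and N: "N \<ge> 1" and t: "0 \<le> t" "t \<le> 1" and \<theta>: "0 \<le> \<theta>"
  shows "ennreal t \<le> sigma_coeff K N t \<theta>"
proof (cases "\<theta> = 0 \<or> K * \<theta>\<^sup>2 \<ge> N * pi\<^sup>2")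
  case True
  then show ?thesis by (auto simp: sigma_coeff_def)
next
  case False
  define \<alpha> where "\<alpha> = \<theta> * sqrt (K / N)"
  have "\<alpha>\<^sup>2 = K * \<theta>\<^sup>2 / N" using K N by (simp add: \<alpha>_def power_mult_distrib)
  also have "\<dots> < pi\<^sup>2" using False N by (simp add: field_simps)
  finally have "\<alpha> < pi" by (rule power2_less_imp_less) simp
  moreover have "\<alpha> > 0" using False \<theta> K N by (simp add: \<alpha>_def)
  ultimately have "sin \<alpha> > 0" "t * sin \<alpha> \<le> sin (t * \<alpha>)"
    using t by (auto intro: sin_gt_zero sin_mult_ge)
  then have "t \<le> sin (t * \<alpha>) / sin \<alpha>" by (simp add: field_simps)
  then have "t \<le> sin (t * \<theta> * sqrt (K / N)) / sin (\<theta> * sqrt (K / N))"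
    by (simp add: \<alpha>_def mult.assoc)
  then show ?thesis using False by (simp add: sigma_coeff_def ennreal_leI)
qed

text \<open>Provides the times at which \<open>CD_star_mass_bound\<close> is applied.\<close>

lemma small_time:
  fixes E r :: real
  assumes "r > 0"
  obtains t where "0 < t" "t < 1" "t * (E\<^sup>2 + 1) \<le> r\<^sup>2"
proof -
  have E: "E\<^sup>2 + 1 > 0" using zero_le_power2[of E] by linarith
  show thesis
  proof (rule that[of "min (1 / 2) (r\<^sup>2 / (E\<^sup>2 + 1))"])
    have "min (1 / 2) (r\<^sup>2 / (E\<^sup>2 + 1)) * (E\<^sup>2 + 1) \<le> r\<^sup>2 / (E\<^sup>2 + 1) * (E\<^sup>2 + 1)"
      using E by (intro mult_right_mono) auto
    then show "min (1 / 2) (r\<^sup>2 / (E\<^sup>2 + 1)) * (E\<^sup>2 + 1) \<le> r\<^sup>2" using E by simp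
  qed (use E assms in auto)
qed

lemma CD_star_dist_le:
  fixes m :: "'a::polish_space measure"
  assumes K: "K > 0" and N: "N \<ge> 1" and m: "metric_measure_space m" and CD: "CD_star K N m"
    and x: "x \<in> msupp m" and y: "y \<in> msupp m"
  shows "dist x y \<le> pi * sqrt (N / K)"
proof (rule ccontr)
  \<comment> \<open>At distance \<open>D\<close> the distortion coefficient becomes
    infinite.\<close>
  define D where "D = pi * sqrt (N / K)"
  have D: "D \<ge> 0" "K * D\<^sup>2 = N * pi\<^sup>2" using K N by (auto simp: D_def power_mult_distrib)
  assume "\<not> dist x y \<le> pi * sqrt (N / K)"
  then have xy: "dist x y > D" by (simp add: D_def)
  obtain R1 where R1: "R1 > 0" "\<And>r. r \<le> R1 \<Longrightarrow> emeasure m (ball x r) < \<infinity>"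
    using metric_measure_space_small_ball[OF m] by blast
  obtain R2 where R2: "R2 > 0" "\<And>r. r \<le> R2 \<Longrightarrow> emeasure m (ball y r) < \<infinity>"
    using metric_measure_space_small_ball[OF m] by blast
  \<comment> \<open>The first two terms make the masses of \<open>ball x (2 * r)\<close> and
    \<open>ball y r\<close> finite; the third keeps the two balls of radius \<open>r\<close> at
    distance at least \<open>D\<close>.\<close>
  define r where "r = min (R1 / 2) (min R2 ((dist x y - D) / 2))"
  have r: "r > 0" using R1 R2 xy by (simp add: r_def)
  have "r \<le> R1 / 2" "r \<le> R2" "r \<le> (dist x y - D) / 2"
    unfolding r_def by linarith+
  then have r_le: "2 * r \<le> R1" "r \<le> R2" "2 * r \<le> dist x y - D" by auto
  define E where "E = dist x y + 2 * r"
  obtain t where t: "0 < t" "t < 1" "t * (E\<^sup>2 + 1) \<le> r\<^sup>2"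
    using small_time[OF r] by blast
  have fin: "emeasure m (ball y r) < \<infinity>" and pos: "emeasure m (ball y r) > 0"
    using R2 r r_le y by (auto intro: msupp_emeasure_ball_pos)
  have "\<infinity> * ennreal (measure m (ball y r) powr (1 / N)) \<le> ennreal (measure m (ball x (2 * r)) powr (1 / N))"
  proof (rule CD_star_mass_bound[OF N m CD r x _ _ _ pos fin _ _ t])
    fix a b assume ab: "a \<in> ball x r" "b \<in> ball y r"
    show "dist a b \<le> E"
      using ab dist_triangle[of a b x] dist_triangle[of x b y] by (simp add: E_def dist_commute)
    have "D \<le> dist a b"
      using ab r_le dist_triangle[of x y a] dist_triangle[of a y b] by (simp add: dist_commute)
    then have "K * D\<^sup>2 \<le> K * (dist a b)\<^sup>2" using K D by (intro mult_left_mono power_mono) auto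
    then show "\<infinity> \<le> sigma_coeff K N t (dist a b)" by (simp add: sigma_coeff_def D)
  qed (use r r_le R1 in \<open>auto simp: E_def\<close>)
  \<comment> \<open>Positivity matters because \<open>\<infinity> * 0 = 0\<close> in
    \<open>ennreal\<close>.\<close>
  moreover have "measure m (ball y r) > 0"
    using fin pos by (simp add: measure_def enn2real_positive_iff)
  ultimately show False by (simp add: ennreal_top_mult top_unique)
qed

section \<open>Volume comparison and total boundedness\<close>

text \<open>The mass inequality with \<open>s = t\<close>, raised to the power \<open>N\<close>.
  Null sets \<open>A\<close> are treated apart, since they cannot be normalized.\<close>

lemma CD_star_volume_comparison:
  fixes m :: "'a::polish_space measure"
  assumes K: "K > 0" and N: "N \<ge> 1" and m: "metric_measure_space m" and CD: "CD_star K N m"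
    and r: "r > 0" and x: "x \<in> msupp m" and fin: "emeasure m (ball x (2 * r)) < \<infinity>"
    and A: "A \<in> sets borel" "bounded A" "emeasure m A < \<infinity>"
    and E: "\<And>a b. a \<in> ball x r \<Longrightarrow> b \<in> A \<Longrightarrow> dist a b \<le> E" "0 \<le> E"
    and t: "0 < t" "t < 1" "t * (E\<^sup>2 + 1) \<le> r\<^sup>2"
  shows "t powr N * measure m A \<le> measure m (ball x (2 * r))"
proof (cases "emeasure m A = 0")
  case True
  then show ?thesis by (simp add: measure_def)
next
  case False
  then have pos: "emeasure m A > 0" by (simp add: zero_less_iff_neq_zero)
  have "ennreal t * ennreal (measure m A powr (1 / N)) \<le> ennreal (measure m (ball x (2 * r)) powr (1 / N))"
    by (rule CD_star_mass_bound[OF N m CD r x fin A(1,2) pos A(3) E t])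
      (use t in \<open>auto intro!: sigma_coeff_ge K N\<close>)
  then have "t * measure m A powr (1 / N) \<le> measure m (ball x (2 * r)) powr (1 / N)"
    using t by (simp flip: ennreal_mult)
  then have "(t * measure m A powr (1 / N)) powr N \<le> (measure m (ball x (2 * r)) powr (1 / N)) powr N"
    using t N by (intro powr_mono2) auto
  then show ?thesis using t N by (simp add: powr_mult powr_powr)
qed

text \<open>Local finiteness controls small balls only. Volume comparison against one small ball
  bounds every finite-mass piece of \<open>ball x \<rho>\<close> by the same constant, which
  survives the exhaustion of the space.\<close>

lemma CD_star_finite_ball:
  fixes m :: "'a::polish_space measure"
  assumes K: "K > 0" and N: "N \<ge> 1" and m: "metric_measure_space m" and CD: "CD_star K N m"
    and x: "x \<in> msupp m"
  shows "emeasure m (ball x \<rho>) < \<infinity>"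
proof -
  have sets: "sets m = sets borel"
    using m by (simp add: metric_measure_space_def)
  interpret sigma_finite_measure m using m by (rule metric_measure_space_sigma_finite)
  obtain F :: "nat \<Rightarrow> 'a set" where F: "range F \<subseteq> sets m" "(\<Union>i. F i) = space m"
    "\<And>i. emeasure m (F i) \<noteq> \<infinity>" "incseq F"
    using sigma_finite_incseq by blast
  obtain R where R: "R > 0" "\<And>r. r \<le> R \<Longrightarrow> emeasure m (ball x r) < \<infinity>"
    using metric_measure_space_small_ball[OF m] by blast
  define r where "r = R / 2"
  have r: "r > 0" "emeasure m (ball x (2 * r)) < \<infinity>" using R by (auto simp: r_def)
  \<comment> \<open>The absolute value keeps \<open>E\<close> nonnegative, as \<open>\<rho>\<close>
    may be negative.\<close>
  define E where "E = \<bar>\<rho>\<bar> + r"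
  obtain t where t: "0 < t" "t < 1" "t * (E\<^sup>2 + 1) \<le> r\<^sup>2"
    using small_time[OF r(1)] by blast
  define C where "C = measure m (ball x (2 * r)) / t powr N"
  have bound: "emeasure m (F i \<inter> ball x \<rho>) \<le> ennreal C" for i
  proof -
    have Fi: "F i \<in> sets borel" using F(1) sets by auto
    have "emeasure m (F i \<inter> ball x \<rho>) \<le> emeasure m (F i)"
      using Fi by (intro emeasure_mono) (auto simp: sets)
    also have "\<dots> < \<infinity>" using F(3) by (simp add: less_top)
    finally have fin: "emeasure m (F i \<inter> ball x \<rho>) < \<infinity>" .
    have "t powr N * measure m (F i \<inter> ball x \<rho>) \<le> measure m (ball x (2 * r))"
    proof (rule CD_star_volume_comparison[OF K N m CD r(1) x r(2) _ _ fin _ _ t])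
      show "dist a b \<le> E" if "a \<in> ball x r" "b \<in> F i \<inter> ball x \<rho>" for a b
        using that dist_triangle[of a b x] abs_ge_self[of \<rho>] by (auto simp: E_def dist_commute)
    qed (use Fi r in \<open>auto simp: E_def intro: bounded_subset[OF bounded_ball]\<close>)
    then have "measure m (F i \<inter> ball x \<rho>) \<le> C"
      using t by (simp add: C_def field_simps)
    then show ?thesis
      using fin by (subst emeasure_eq_ennreal_measure) (auto intro: ennreal_leI)
  qed
  have "emeasure m (ball x \<rho>) = emeasure m (\<Union>i. F i \<inter> ball x \<rho>)"
    using F(2) sets_eq_imp_space_eq[OF sets] by (intro arg_cong[where f="emeasure m"]) auto
  also have "\<dots> = (SUP i. emeasure m (F i \<inter> ball x \<rho>))"
    using F by (intro SUP_emeasure_incseq[symmetric]) (auto simp: incseq_def sets subset_eq)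
  also have "\<dots> \<le> ennreal C" by (intro SUP_least bound)
  also have "\<dots> < \<infinity>" by simp
  finally show ?thesis .
qed

text \<open>A packing argument: disjoint balls of uniformly positive mass inside one ball of finite
  mass are boundedly many, and a largest separated set is a net.\<close>

lemma CD_star_finite_cover:
  fixes m :: "'a::polish_space measure"
  assumes K: "K > 0" and N: "N \<ge> 1" and m: "metric_measure_space m" and CD: "CD_star K N m"
    and "\<epsilon> > 0"
  shows "\<exists>k. finite k \<and> msupp m \<subseteq> (\<Union>x\<in>k. ball x \<epsilon>)"
proof (cases "msupp m = {}")
  case True
  then show ?thesis by auto
next
  case False
  then obtain x0 where x0: "x0 \<in> msupp m" by blast
  have sets: "sets m = sets borel"
    using m by (simp add: metric_measure_space_def)
  define D where "D = pi * sqrt (N / K)"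
  have D: "D \<ge> 0" using K N by (simp add: D_def)
  have dist: "dist x y \<le> D" if "x \<in> msupp m" "y \<in> msupp m" for x y
    unfolding D_def using that by (rule CD_star_dist_le[OF K N m CD])
  \<comment> \<open>With this radius the balls of radius \<open>2 * r\<close> around
    \<open>\<epsilon>\<close>-separated points are disjoint.\<close>
  define r where "r = \<epsilon> / 4"
  have r: "r > 0" using \<open>\<epsilon> > 0\<close> by (simp add: r_def)
  \<comment> \<open>This bound works for all centres \<open>x\<close> in the support at once, so
    \<open>t\<close> and the lower mass bound \<open>c\<close> do not depend on
    \<open>x\<close>.\<close>
  define E where "E = r + D + 1"
  obtain t where t: "0 < t" "t < 1" "t * (E\<^sup>2 + 1) \<le> r\<^sup>2"
    using small_time[OF r] by blast
  note finite_ball = CD_star_finite_ball[OF K N m CD]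
  define c where "c = t powr N * measure m (ball x0 1)"
  have "measure m (ball x0 1) > 0"
    using msupp_emeasure_ball_pos[OF x0, of 1] finite_ball[OF x0, of 1]
    by (simp add: measure_def enn2real_positive_iff)
  then have c: "c > 0" using t by (simp add: c_def)
  have lower: "c \<le> measure m (ball x (2 * r))" if x: "x \<in> msupp m" for x
    unfolding c_def
  proof (rule CD_star_volume_comparison[OF K N m CD r x finite_ball[OF x] _ _ finite_ball[OF x0] _ _ t])
    show "dist a b \<le> E" if "a \<in> ball x r" "b \<in> ball x0 1" for a b
      using that dist[OF x x0] dist_triangle[of a b x] dist_triangle[of x b x0]
      by (simp add: E_def dist_commute)
  qed (use r D in \<open>auto simp: E_def\<close>)
  \<comment> \<open>The ball used here contains \<open>ball x (2 * r)\<close> for every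
    \<open>x\<close> in the support.\<close>
  define C where "C = measure m (ball x0 (D + 2 * r))"
  define S where "S F \<longleftrightarrow> finite F \<and> F \<subseteq> msupp m \<and> (\<forall>x\<in>F. \<forall>y\<in>F. x \<noteq> y \<longrightarrow> \<epsilon> \<le> dist x y)" for F
  have card_le: "card F \<le> nat \<lceil>C / c\<rceil>" if F: "S F" for F
  proof -
    have fin: "finite F" "F \<subseteq> msupp m" using F by (auto simp: S_def)
    have "real (card F) * c = (\<Sum>x\<in>F. c)" by simp
    also have "\<dots> \<le> (\<Sum>x\<in>F. measure m (ball x (2 * r)))"
      using fin by (intro sum_mono lower) auto
    also have "\<dots> = measure m (\<Union>x\<in>F. ball x (2 * r))"
    proof (rule measure_finite_Union[symmetric])
      show "disjoint_family_on (\<lambda>x. ball x (2 * r)) F"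
        unfolding disjoint_family_on_def
      proof (intro ballI impI)
        fix x y assume "x \<in> F" "y \<in> F" "x \<noteq> y"
        then have "4 * r \<le> dist x y" using F by (auto simp: S_def r_def)
        then show "ball x (2 * r) \<inter> ball y (2 * r) = {}"
          by (intro disjoint_ballI) simp
      qed
      show "emeasure m (ball x (2 * r)) \<noteq> \<infinity>" if "x \<in> F" for x
        using finite_ball[of x "2 * r"] that fin by auto
    qed (use fin in \<open>auto simp: sets\<close>)
    also have "\<dots> \<le> C"
      unfolding C_def
    proof (rule measure_mono_fmeasurable)
      show "(\<Union>x\<in>F. ball x (2 * r)) \<subseteq> ball x0 (D + 2 * r)"
      proof
        fix z assume "z \<in> (\<Union>x\<in>F. ball x (2 * r))"
        then obtain x where "x \<in> F" "dist x z < 2 * r" by auto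
        then show "z \<in> ball x0 (D + 2 * r)"
          using dist[OF x0, of x] fin dist_triangle[of x0 z x] by auto
      qed
    qed (use finite_ball[OF x0] fin in \<open>auto simp: sets fmeasurable_def intro!: borel_open\<close>)
    finally have "real (card F) \<le> C / c" using c by (simp add: field_simps)
    then show ?thesis by linarith
  qed
  have "S {}" by (simp add: S_def)
  \<comment> \<open>Bounded cardinality yields a separated set of largest size; any point not
    covered by its balls could be added to it.\<close>
  then have "\<exists>F. S F \<and> (\<forall>G. S G \<longrightarrow> card G \<le> card F)"
    by (rule ex_has_greatest_nat[where b="Suc (nat \<lceil>C / c\<rceil>)"])
      (use card_le in \<open>simp add: less_Suc_eq_le\<close>)
  then obtain F where F: "S F" and max: "\<And>G. S G \<Longrightarrow> card G \<le> card F" by blast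
  have "x \<in> (\<Union>y\<in>F. ball y \<epsilon>)" if x: "x \<in> msupp m" for x
  proof (rule ccontr)
    assume "x \<notin> (\<Union>y\<in>F. ball y \<epsilon>)"
    then have far: "\<forall>y\<in>F. \<epsilon> \<le> dist x y \<and> \<epsilon> \<le> dist y x" by (force simp: dist_commute)
    then have "x \<notin> F" using \<open>\<epsilon> > 0\<close> by force
    moreover have "S (insert x F)" using F x far by (auto simp: S_def)
    ultimately show False using max[of "insert x F"] F by (auto simp: S_def)
  qed
  then show ?thesis using F by (auto simp: S_def)
qed

theorem corollary6p3:
  fixes m :: "'a::polish_space measure" and K N :: real
  assumes "K > 0" and "N \<ge> 1"
    and "metric_measure_space m"
    and "CD_star K N m"
  shows "compact (msupp m) \<and> diameter (msupp m) \<le> pi * sqrt (N / K)"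
proof
  show "compact (msupp m)"
    unfolding compact_eq_totally_bounded
    using CD_star_finite_cover[OF assms] closed_msupp[of m] by (simp add: complete_eq_closed)
  show "diameter (msupp m) \<le> pi * sqrt (N / K)"
    \<comment> \<open>For empty support, \<open>diameter\<close> has the default value
      \<open>0\<close>, and the bound is nonnegative.\<close>
    unfolding diameter_def using CD_star_dist_le[OF assms] assms(1,2)
    by (auto intro!: cSUP_least)
qed

end
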